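(* For each prime number $p \equiv 1 \bmod 4$ there exists a prime number $q \equiv 3 \bmod 4$ such that $\left(\frac{p}{q}\right) = -1$.
   Context: $\left(\frac{p}{q}\right)$ denotes the Legendre symbol modulo the odd prime $q$. *)

theory Defs
  imports "HOL-Number_Theory.Number_Theory"
begin

end

theory Submission
  imports Defs "HOL-Analysis.Summation_Tests"
begin

text \<open>
  Let \<open>a\<close> be the character mod 4 and \<open>b\<close> the Legendre symbol mod \<open>p\<close> restricted to odd
  numbers, and suppose that no prime \<open>q\<close> has \<open>a q = b q = -1\<close>. Then the Dirichlet convolution
  \<open>h = a * b\<close> is nonnegative, and \<open>h (m\<^sup>2) \<ge> 1\<close> for all odd \<open>m\<close>, so \<open>\<Sum>n\<le>N\<^sup>2. h n / sqrt n\<close>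
  grows at least like a harmonic sum. On the other hand, both characters have bounded partial sums, and
  Dirichlet's hyperbola method shows that this sum stays bounded. A prime with \<open>a q = b q = -1\<close> is
  as required by quadratic reciprocity.
\<close>

section \<open>Divisor sums, partial summation and the hyperbola method\<close>

lemma sum_divisors_prime_mult:
  fixes F :: "nat \<Rightarrow> 'a::comm_monoid_add"
  assumes q: "prime q" and m: "\<not> q dvd m" "m > 0"
  shows "(\<Sum>d | d dvd q ^ Suc k * m. F d) =
    (\<Sum>d | d dvd q ^ k * m. F (q * d)) + (\<Sum>d | d dvd m. F d)"
proof -
  have q0: "q > 0" using q by (simp add: prime_gt_0_nat)
  \<comment> \<open>A divisor divisible by \<open>q\<close> loses one factor \<open>q\<close> and
    becomes a divisor of \<open>q ^ k * m\<close>. Any other divisor is coprime to \<open>q\<close>,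
    hence divides \<open>m\<close>.\<close>
  have split: "{d. d dvd q ^ Suc k * m} = (*) q ` {d. d dvd q ^ k * m} \<union> {d. d dvd m}" (is "?L = ?R")
  proof
    show "?L \<subseteq> ?R"
    proof
      fix d assume "d \<in> ?L"
      then have d: "d dvd q ^ Suc k * m" by simp
      show "d \<in> ?R"
      proof (cases "q dvd d")
        case True
        then obtain c where c: "d = q * c" by blast
        with d q0 have "c dvd q ^ k * m" by (simp add: mult.assoc)
        with c show ?thesis by blast
      next
        case False
        then have "coprime d (q ^ Suc k)"
          using q by (metis coprime_commute coprime_power_left_iff prime_imp_coprime)
        with d show ?thesis by (simp add: coprime_dvd_mult_right_iff)
      qed
    qed
    show "?R \<subseteq> ?L" by (auto simp: mult.assoc)
  qed
  have "(*) q ` {d. d dvd q ^ k * m} \<inter> {d. d dvd m} = {}"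
    using m by (auto dest: dvd_mult_left)
  moreover have "finite {d. d dvd q ^ k * m}" "finite {d. d dvd m}"
    using q0 m by simp_all
  moreover have "inj_on ((*) q) {d. d dvd q ^ k * m}"
    using q0 by (auto simp: inj_on_def)
  ultimately show ?thesis
    unfolding split by (simp add: sum.union_disjoint sum.reindex)
qed

text \<open>The sum is the local factor of the convolution at a prime where the characters take the
  values \<open>a\<close> and \<open>b\<close>. The hypothesis on \<open>a + b\<close> leaves only
  sums of zeros and ones, with first term 1 when \<open>a = 1\<close> and \<open>b\<close> is 0 or
  1, and the mixed-sign cases, where the sum alternates between 1 and 0.\<close>

lemma sum_power_mult_power_bounds:
  fixes a b :: real
  assumes "a \<in> {-1, 0, 1}" "b \<in> {-1, 0, 1}" "a + b \<ge> 0"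
  shows "0 \<le> (\<Sum>j\<le>k. a ^ j * b ^ (k - j))"
    and "a \<noteq> 0 \<Longrightarrow> even k \<Longrightarrow> 1 \<le> (\<Sum>j\<le>k. a ^ j * b ^ (k - j))"
proof -
  define G where "G k = (\<Sum>j\<le>k. a ^ j * b ^ (k - j))" for k
  have G0: "G 0 = 1" by (simp add: G_def)
  have "G (Suc k) = a ^ Suc k + b * G k" for k
  proof -
    have "(\<Sum>j\<le>k. a ^ j * b ^ (Suc k - j)) = b * G k"
      unfolding G_def sum_distrib_left by (intro sum.cong) (auto simp: Suc_diff_le)
    then show ?thesis by (simp add: G_def)
  qed
  note GS = this
  have "0 \<le> G k \<and> (a \<noteq> 0 \<longrightarrow> even k \<longrightarrow> 1 \<le> G k)"
  proof -
    consider "a = 0" "b = 0 \<or> b = 1" | "a = 1" "b = 0 \<or> b = 1" | "a = 1" "b = -1" | "a = -1" "b = 1"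
      using assms by auto
    then show ?thesis
    proof cases
      case 1
      then have "0 \<le> G k" by (induction k) (auto simp: G0 GS)
      with 1 show ?thesis by simp
    next
      case 2
      then have "1 \<le> G k" by (induction k) (auto simp: G0 GS)
      then show ?thesis by simp
    next
      case 3
      then have "G k = (if even k then 1 else 0)" by (induction k) (auto simp: G0 GS)
      then show ?thesis by simp
    next
      case 4
      then have "G k = (if even k then 1 else 0)" by (induction k) (auto simp: G0 GS)
      then show ?thesis by simp
    qed
  qed
  then show "0 \<le> (\<Sum>j\<le>k. a ^ j * b ^ (k - j))"
    and "a \<noteq> 0 \<Longrightarrow> even k \<Longrightarrow> 1 \<le> (\<Sum>j\<le>k. a ^ j * b ^ (k - j))"
    by (simp_all add: G_def)
qed

text \<open>Abel summation: with bounded sums of \<open>f\<close> and decreasing weights, only the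
  first weight matters, because the differences of consecutive weights telescope.\<close>

lemma abs_weighted_sum_le:
  fixes f w :: "nat \<Rightarrow> real"
  assumes K: "\<And>z. \<bar>\<Sum>d\<in>{y<..z}. f d\<bar> \<le> K"
    and w: "\<And>d. d > y \<Longrightarrow> w (Suc d) \<le> w d" "\<And>d. d > y \<Longrightarrow> 0 \<le> w d"
  shows "\<bar>\<Sum>d\<in>{y<..z}. f d * w d\<bar> \<le> K * w (Suc y)"
proof (cases "y < z")
  case False
  have "0 \<le> K" using K[of 0] by linarith
  with False w(2)[of "Suc y"] show ?thesis by simp
next
  case True
  define S where "S z = (\<Sum>d\<in>{y<..z}. f d)" for z
  define T where "T z = (\<Sum>d\<in>{y<..z}. f d * w d)" for z
  have "Suc y \<le> z" using True by simp
  \<comment> \<open>Subtracting the boundary term \<open>S z * w z\<close> makes the claim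
    inductive: each step adds \<open>S z\<close> times one difference of weights.\<close>
  then have "\<bar>T z - S z * w z\<bar> \<le> K * (w (Suc y) - w z)"
  proof (induction z rule: dec_induct)
    case base
    show ?case by (simp add: T_def S_def atLeastSucAtMost_greaterThanAtMost [symmetric])
  next
    case (step z)
    have "{y<..Suc z} = insert (Suc z) {y<..z}" using step.hyps by auto
    then have "T (Suc z) = T z + f (Suc z) * w (Suc z)" "S (Suc z) = S z + f (Suc z)"
      by (simp_all add: T_def S_def)
    then have "T (Suc z) - S (Suc z) * w (Suc z) = (T z - S z * w z) + S z * (w z - w (Suc z))"
      by (simp add: algebra_simps)
    moreover have "\<bar>S z * (w z - w (Suc z))\<bar> \<le> K * (w z - w (Suc z))"
      using K[of z] w(1)[of z] step.hyps by (simp add: S_def abs_mult mult_right_mono)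
    ultimately show ?case using step.IH by (simp add: algebra_simps)
  qed
  moreover have "\<bar>S z * w z\<bar> \<le> K * w z"
    using K[of z] w(2)[of z] True by (simp add: S_def abs_mult mult_right_mono)
  ultimately show ?thesis by (simp add: T_def algebra_simps)
qed

text \<open>Each term is at most the increment of the right-hand side:
  \<open>(?t - ?s) * (?t + ?s) = 1\<close> and \<open>?t + ?s\<close> is at most
  \<open>2 * ?t\<close>.\<close>

lemma sum_inverse_sqrt_le: "(\<Sum>d\<in>{1..N}. 1 / sqrt (real d)) \<le> 2 * sqrt (real N)"
proof (induction N)
  case (Suc N)
  let ?s = "sqrt (real N)" and ?t = "sqrt (real (Suc N))"
  have st: "?s \<le> ?t" "?t > 0" by simp_all
  have "(?t - ?s) * (2 * ?t) \<ge> (?t - ?s) * (?t + ?s)"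
    using st by (intro mult_left_mono) auto
  moreover have "(?t - ?s) * (?t + ?s) = 1"
    by (simp add: algebra_simps)
  ultimately have "1 / ?t \<le> 2 * (?t - ?s)"
    using st by (simp add: field_simps)
  then show ?case using Suc by simp
qed simp

text \<open>The left side sums over pairs with \<open>d * e\<close> at most the square of
  \<open>N\<close>. Pairs with \<open>d\<close> at most \<open>N\<close> give the first sum; all
  others have \<open>e\<close> at most \<open>N\<close> and give the second. Starting the second
  inner sum above \<open>N\<close> avoids counting any pair twice.\<close>

lemma sum_hyperbola:
  fixes u v :: "nat \<Rightarrow> real"
  shows "(\<Sum>n\<in>{1..N\<^sup>2}. \<Sum>d | d dvd n. u d * v (n div d)) =
    (\<Sum>d\<in>{1..N}. u d * (\<Sum>e\<in>{1..N\<^sup>2 div d}. v e)) +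
    (\<Sum>e\<in>{1..N}. v e * (\<Sum>d\<in>{N<..N\<^sup>2 div e}. u d))"
proof -
  let ?A = "SIGMA d:{1..N}. {1..N\<^sup>2 div d}" and ?B = "SIGMA e:{1..N}. {N<..N\<^sup>2 div e}"
  define P where "P = {(d, e). 0 < d \<and> 0 < e \<and> d * e \<le> N\<^sup>2}"
  have small: "e \<le> N" if "d * e \<le> N\<^sup>2" "N < d" for d e
  proof (rule ccontr)
    assume "\<not> e \<le> N"
    with that(2) have "N * N < d * e" by (intro mult_strict_mono') simp_all
    with that(1) show False by (simp add: power2_eq_square)
  qed
  have P: "P = ?A \<union> prod.swap ` ?B"
  proof (rule Set.set_eqI)
    fix x :: "nat \<times> nat"
    obtain d e where x: "x = (d, e)" by (cases x)
    show "x \<in> P \<longleftrightarrow> x \<in> ?A \<union> prod.swap ` ?B"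
      using small[of d e] unfolding P_def x
      by (cases "d \<le> N")
        (auto simp: less_eq_div_iff_mult_less_eq mult.commute image_iff Suc_le_eq)
  qed
  have "(\<Sum>n\<in>{1..N\<^sup>2}. \<Sum>d | d dvd n. u d * v (n div d)) =
      (\<Sum>(n, d)\<in>(SIGMA n:{1..N\<^sup>2}. {d. d dvd n}). u d * v (n div d))"
    by (rule sum.Sigma) auto
  also have "\<dots> = (\<Sum>(d, e)\<in>P. u d * v e)"
    by (rule sum.reindex_bij_witness[where i = "\<lambda>(d, e). (d * e, d)" and j = "\<lambda>(n, d). (d, n div d)"])
      (auto simp: P_def Suc_le_eq dvd_div_eq_0_iff intro: Nat.gr0I)
  also have "\<dots> = (\<Sum>(d, e)\<in>?A. u d * v e) + (\<Sum>(d, e)\<in>prod.swap ` ?B. u d * v e)"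
    unfolding P by (rule sum.union_disjoint) auto
  also have "(\<Sum>(d, e)\<in>?A. u d * v e) = (\<Sum>d\<in>{1..N}. u d * (\<Sum>e\<in>{1..N\<^sup>2 div d}. v e))"
    by (simp add: sum_distrib_left sum.Sigma)
  also have "(\<Sum>(d, e)\<in>prod.swap ` ?B. u d * v e) = (\<Sum>(e, d)\<in>?B. v e * u d)"
    by (subst sum.reindex) (auto simp: mult.commute case_prod_beta intro: sum.cong)
  also have "\<dots> = (\<Sum>e\<in>{1..N}. v e * (\<Sum>d\<in>{N<..N\<^sup>2 div e}. u d))"
    by (simp add: sum_distrib_left sum.Sigma)
  finally show ?thesis .
qed

section \<open>Real nonprincipal characters and their bounded partial sums\<close>

locale nonprincipal_real_character =
  fixes M :: nat and f :: "nat \<Rightarrow> real"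
  assumes mult: "f (m * n) = f m * f n"
    and periodic: "f (n mod M) = f n"
    and range: "f n \<in> {-1, 0, 1}"
    and zero_iff: "f n = 0 \<longleftrightarrow> \<not> coprime n M"
    and nonprincipal: "\<exists>a. f a = -1"
    and modulus_pos: "M > 0"
begin

lemma one: "f 1 = 1"
  using mult[of 1 1] zero_iff[of 1] by simp

lemma power: "f (n ^ k) = f n ^ k"
  by (induction k) (use one mult in auto)

lemma abs_le_1: "\<bar>f n\<bar> \<le> 1"
  using range[of n] by auto

text \<open>Multiplication by an \<open>a\<close> with \<open>f a = -1\<close> permutes the residues
  modulo \<open>M\<close>, so the sum equals its own negative.\<close>

lemma sum_period: "(\<Sum>n<M. f n) = 0"
proof -
  obtain a where a: "f a = -1" using nonprincipal by blast
  then have co: "coprime a M" using zero_iff[of a] by auto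
  have "inj_on (\<lambda>n. a * n mod M) {..<M}"
  proof (rule inj_onI)
    fix x y assume "x \<in> {..<M}" "y \<in> {..<M}" "a * x mod M = a * y mod M"
    then have "[a * x = a * y] (mod M)" "x < M" "y < M" by (auto simp: cong_def)
    then show "x = y" using co
      by (metis cong_def cong_mult_lcancel_nat mod_less)
  qed
  moreover have "(\<lambda>n. a * n mod M) ` {..<M} \<subseteq> {..<M}" using modulus_pos by auto
  ultimately have "bij_betw (\<lambda>n. a * n mod M) {..<M} {..<M}"
    by (simp add: bij_betw_def endo_inj_surj)
  then have "(\<Sum>n<M. f n) = (\<Sum>n<M. f (a * n mod M))"
    by (rule sum.reindex_bij_betw [symmetric])
  also have "\<dots> = - (\<Sum>n<M. f n)"
    by (simp add: periodic mult a sum_negf)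
  finally show ?thesis by simp
qed

text \<open>Full periods cancel, so they can be removed until fewer than \<open>M\<close> terms
  remain, each of absolute value at most 1.\<close>

lemma abs_partial_sum_le: "\<bar>\<Sum>n<N. f n\<bar> \<le> M"
proof (induction N rule: less_induct)
  case (less N)
  show ?case
  proof (cases "N < M")
    case True
    have "\<bar>\<Sum>n<N. f n\<bar> \<le> (\<Sum>n<N. 1)"
      by (rule order.trans[OF sum_abs sum_mono]) (rule abs_le_1)
    with True show ?thesis by simp
  next
    case False
    then obtain L where N: "N = M + L" by (metis le_iff_add not_less)
    have shift: "f (n + M) = f n" for n using periodic[of "n + M"] periodic[of n] by simp
    have "(\<Sum>n<N. f n) = (\<Sum>n\<in>{0..<M}. f n) + (\<Sum>n\<in>{0 + M..<L + M}. f n)"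
      by (simp add: N lessThan_atLeast0 sum.atLeastLessThan_concat add.commute)
    also have "\<dots> = (\<Sum>n<L. f n)"
      unfolding sum.shift_bounds_nat_ivl shift
      using sum_period by (simp add: lessThan_atLeast0)
    finally have "(\<Sum>n<N. f n) = (\<Sum>n<L. f n)" .
    with less.IH[of L] N modulus_pos show ?thesis by simp
  qed
qed

text \<open>An interval sum is a difference of two initial sums, whence the factor 2.\<close>

lemma abs_interval_sum_le: "\<bar>\<Sum>n\<in>{y<..z}. f n\<bar> \<le> 2 * M"
proof (cases "y \<le> z")
  case True
  have "{..<Suc z} = {..<Suc y} \<union> {y<..z}" using True by auto
  moreover have "sum f ({..<Suc y} \<union> {y<..z}) = (\<Sum>n<Suc y. f n) + (\<Sum>n\<in>{y<..z}. f n)"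
    by (rule sum.union_disjoint) auto
  ultimately have "(\<Sum>n<Suc z. f n) = (\<Sum>n<Suc y. f n) + (\<Sum>n\<in>{y<..z}. f n)"
    by (rule subst[OF sym])
  with abs_partial_sum_le[of "Suc z"] abs_partial_sum_le[of "Suc y"] show ?thesis by linarith
qed simp

lemma abs_tail_le: "\<bar>\<Sum>n\<in>{y<..z}. f n / sqrt n\<bar> \<le> 2 * M / sqrt (Suc y)"
  using abs_weighted_sum_le[of f y "2 * M" "\<lambda>n. 1 / sqrt n" z] abs_interval_sum_le
  by (simp add: frac_le)

end

section \<open>The convolution of two real characters\<close>

locale two_real_characters =
  a: nonprincipal_real_character M a + b: nonprincipal_real_character L b for M a L b
begin

definition conv :: "nat \<Rightarrow> real"
  where "conv n = (\<Sum>d | d dvd n. a d * b (n div d))"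

text \<open>Induction on the exponent, separating the divisors divisible by \<open>q\<close> from
  those of \<open>m\<close>: the former contribute \<open>a q * conv (q ^ k * m)\<close>, the latter
  \<open>b q ^ Suc k * conv m\<close>.\<close>

lemma conv_prime_power_mult:
  assumes q: "prime q" and m: "\<not> q dvd m" "m > 0"
  shows "conv (q ^ k * m) = (\<Sum>j\<le>k. a q ^ j * b q ^ (k - j)) * conv m"
proof (induction k)
  case 0
  show ?case by simp
next
  case (Suc k)
  have q0: "q > 0" using q by (simp add: prime_gt_0_nat)
  have "conv (q ^ Suc k * m) = (\<Sum>d | d dvd q ^ k * m. a (q * d) * b (q ^ Suc k * m div (q * d)))
      + (\<Sum>d | d dvd m. a d * b (q ^ Suc k * m div d))"
    unfolding conv_def by (rule sum_divisors_prime_mult[OF q m])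
  also have "(\<Sum>d | d dvd q ^ k * m. a (q * d) * b (q ^ Suc k * m div (q * d))) = a q * conv (q ^ k * m)"
    unfolding conv_def sum_distrib_left
    using q0 by (intro sum.cong) (auto simp: a.mult mult.assoc)
  also have "(\<Sum>d | d dvd m. a d * b (q ^ Suc k * m div d)) = b q ^ Suc k * conv m"
    unfolding conv_def sum_distrib_left
    by (intro sum.cong) (auto simp: div_mult_swap[symmetric] b.mult b.power simp del: power_Suc)
  \<comment> \<open>The term \<open>j = 0\<close> of the new local factor is
    \<open>b q ^ Suc k\<close>; the others are \<open>a q\<close> times the factor for
    \<open>k\<close>, with the index shifted.\<close>
  finally show ?case
    unfolding Suc sum.atMost_Suc_shift
    by (simp add: sum_distrib_left sum_distrib_right algebra_simps)
qed

text \<open>Splitting off the full power of one prime factor reduces both claims to a local factor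
  and a smaller number. In a square every exponent is even, and \<open>a n\<close> being nonzero
  makes \<open>a\<close> nonzero at each prime factor, so each local factor is at least 1.\<close>

lemma conv_bounds:
  assumes sgn: "\<And>q. prime q \<Longrightarrow> a q + b q \<ge> 0" and "n > 0"
  shows "conv n \<ge> 0 \<and> (a n \<noteq> 0 \<longrightarrow> conv (n\<^sup>2) \<ge> 1)"
  using \<open>n > 0\<close>
proof (induction n rule: less_induct)
  case (less n)
  show ?case
  proof (cases "n = 1")
    case True
    then show ?thesis using a.one b.one by (simp add: conv_def)
  next
    case False
    then obtain q where q: "prime q" "q dvd n" using prime_factor_nat by blast
    define k where "k = multiplicity q n"
    obtain m where m: "n = q ^ k * m" "\<not> q dvd m"
      using multiplicity_decompose'[of n q] less.prems q(1) not_prime_unit unfolding k_def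
      by (metis gr_implies_not0)
    have k: "k > 0" using m q(2) by (intro Nat.gr0I) auto
    have m0: "m > 0" using m(2) by (intro Nat.gr0I) auto
    have "q ^ k > 1" using k q(1) prime_gt_1_nat one_less_power by blast
    with m0 have "m < n" using m(1) by simp
    note IH = less.IH[OF this m0]
    note G = sum_power_mult_power_bounds[OF a.range[of q] b.range[of q] sgn[OF q(1)]]
    have "conv n \<ge> 0"
      unfolding m(1) conv_prime_power_mult[OF q(1) m(2) m0] using G(1) IH by simp
    moreover have "conv (n\<^sup>2) \<ge> 1" if "a n \<noteq> 0"
    proof -
      have nz: "a q \<noteq> 0" "a m \<noteq> 0"
        using that k unfolding m(1) by (auto simp: a.mult a.power)
      have "\<not> q dvd m\<^sup>2" using m(2) q(1) prime_dvd_power by blast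
      then have "conv (n\<^sup>2) = (\<Sum>j\<le>2 * k. a q ^ j * b q ^ (2 * k - j)) * conv (m\<^sup>2)"
        using conv_prime_power_mult[OF q(1), of "m\<^sup>2" "2 * k"] m0
        by (simp add: m(1) power_mult_distrib power_mult [symmetric] mult.commute[of k])
      moreover have "conv (m\<^sup>2) \<ge> 1" using IH nz by blast
      ultimately show ?thesis
        using mult_mono[OF G(2)[OF nz(1), of "2 * k"], of 1 "conv (m\<^sup>2)"] G(1)[of "2 * k"] by simp
    qed
    ultimately show ?thesis by blast
  qed
qed

text \<open>The hyperbola method yields a product of two bounded sums up to \<open>N\<close>,
  contributing \<open>4 * M * L\<close>, and two tail terms, contributing \<open>4 * L\<close> and
  \<open>4 * M\<close>.\<close>

lemma sum_conv_le: "(\<Sum>n\<in>{1..N\<^sup>2}. conv n / sqrt n) \<le> 4 * M * L + 4 * M + 4 * L"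
proof -
  define u where "u n = a n / sqrt n" for n
  define v where "v n = b n / sqrt n" for n
  have u: "\<bar>u n\<bar> \<le> 1 / sqrt n" and v: "\<bar>v n\<bar> \<le> 1 / sqrt n" for n
    using a.abs_le_1[of n] b.abs_le_1[of n] by (simp_all add: u_def v_def divide_right_mono)
  have tail_u: "\<bar>\<Sum>n\<in>{y<..z}. u n\<bar> \<le> 2 * M / sqrt (Suc y)"
    and tail_v: "\<bar>\<Sum>n\<in>{y<..z}. v n\<bar> \<le> 2 * L / sqrt (Suc y)" for y z
    unfolding u_def v_def by (rule a.abs_tail_le b.abs_tail_le)+
  \<comment> \<open>The outer weights add up to at most \<open>2 * sqrt N\<close>, which cancels the
    decay \<open>c / sqrt (Suc N)\<close> of the inner tails.\<close>
  have error: "\<bar>\<Sum>d\<in>{1..N}. s d * (\<Sum>e\<in>{N<..N\<^sup>2 div d}. t e)\<bar> \<le> 2 * c"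
    if s: "\<And>n. \<bar>s n\<bar> \<le> 1 / sqrt n" and t: "\<And>z. \<bar>\<Sum>n\<in>{N<..z}. t n\<bar> \<le> c / sqrt (Suc N)"
    for s t :: "nat \<Rightarrow> real" and c
  proof -
    have "0 \<le> c / sqrt (Suc N)" using t[of 0] by linarith
    then have c: "0 \<le> c" by (simp add: zero_le_divide_iff)
    have "\<bar>\<Sum>d\<in>{1..N}. s d * (\<Sum>e\<in>{N<..N\<^sup>2 div d}. t e)\<bar>
        \<le> (\<Sum>d\<in>{1..N}. 1 / sqrt d * (c / sqrt (Suc N)))"
      by (rule order.trans[OF sum_abs sum_mono]) (auto simp only: abs_mult intro!: mult_mono s t, simp_all)
    also have "\<dots> = (\<Sum>d\<in>{1..N}. 1 / sqrt d) * (c / sqrt (Suc N))"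
      by (simp only: sum_distrib_right)
    also have "\<dots> \<le> 2 * sqrt (Suc N) * (c / sqrt (Suc N))"
      using sum_inverse_sqrt_le[of N] c
      by (intro mult_right_mono) (auto intro: order.trans simp del: of_nat_Suc)
    finally show ?thesis by simp
  qed
  \<comment> \<open>The square root is multiplicative, so the weight distributes over the two
    factors of the convolution.\<close>
  have "conv n / sqrt n = (\<Sum>d | d dvd n. u d * v (n div d))" for n
    unfolding conv_def sum_divide_distrib u_def v_def
    by (intro sum.cong) (auto simp: real_sqrt_mult elim!: dvdE)
  then have "(\<Sum>n\<in>{1..N\<^sup>2}. conv n / sqrt n) =
      (\<Sum>d\<in>{1..N}. u d * (\<Sum>e\<in>{1..N\<^sup>2 div d}. v e)) +
      (\<Sum>e\<in>{1..N}. v e * (\<Sum>d\<in>{N<..N\<^sup>2 div e}. u d))"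
    by (simp only: sum_hyperbola)
  \<comment> \<open>Cutting the inner sum at \<open>N\<close> makes its main part independent of
    \<open>d\<close>.\<close>
  also have "(\<Sum>d\<in>{1..N}. u d * (\<Sum>e\<in>{1..N\<^sup>2 div d}. v e)) =
      (\<Sum>d\<in>{1..N}. u d * ((\<Sum>e\<in>{1..N}. v e) + (\<Sum>e\<in>{N<..N\<^sup>2 div d}. v e)))"
  proof (rule sum.cong)
    fix d assume d: "d \<in> {1..N}"
    then have "d * N \<le> N\<^sup>2" by (simp add: power2_eq_square)
    with d have "N \<le> N\<^sup>2 div d" by (simp add: less_eq_div_iff_mult_less_eq mult.commute)
    then have "{1..N\<^sup>2 div d} = {1..N} \<union> {N<..N\<^sup>2 div d}" by auto
    moreover have "sum v ({1..N} \<union> {N<..N\<^sup>2 div d}) = (\<Sum>e\<in>{1..N}. v e) + (\<Sum>e\<in>{N<..N\<^sup>2 div d}. v e)"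
      by (rule sum.union_disjoint) auto
    ultimately have "(\<Sum>e\<in>{1..N\<^sup>2 div d}. v e) = (\<Sum>e\<in>{1..N}. v e) + (\<Sum>e\<in>{N<..N\<^sup>2 div d}. v e)"
      by (rule subst[OF sym])
    then show "u d * (\<Sum>e\<in>{1..N\<^sup>2 div d}. v e) = u d * ((\<Sum>e\<in>{1..N}. v e) + (\<Sum>e\<in>{N<..N\<^sup>2 div d}. v e))"
      by simp
  qed simp
  also have "\<dots> = (\<Sum>d\<in>{1..N}. u d) * (\<Sum>e\<in>{1..N}. v e) +
      (\<Sum>d\<in>{1..N}. u d * (\<Sum>e\<in>{N<..N\<^sup>2 div d}. v e))"
    by (simp add: distrib_left sum.distrib sum_distrib_right)
  finally have eq: "(\<Sum>n\<in>{1..N\<^sup>2}. conv n / sqrt n) =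
      (\<Sum>d\<in>{1..N}. u d) * (\<Sum>e\<in>{1..N}. v e) +
      (\<Sum>d\<in>{1..N}. u d * (\<Sum>e\<in>{N<..N\<^sup>2 div d}. v e)) +
      (\<Sum>e\<in>{1..N}. v e * (\<Sum>d\<in>{N<..N\<^sup>2 div e}. u d))" .
  have I: "{1..N} = {0<..N}" by auto
  have "\<bar>(\<Sum>d\<in>{1..N}. u d) * (\<Sum>e\<in>{1..N}. v e)\<bar> \<le> real (2 * M) * real (2 * L)"
    unfolding abs_mult I using tail_u[of 0 N] tail_v[of 0 N] by (intro mult_mono) simp_all
  with eq error[of u v "2 * L", OF u tail_v] error[of v u "2 * M", OF v tail_u]
  show ?thesis by simp
qed

text \<open>Otherwise \<open>conv\<close> is nonnegative and at least 1 at the squares of numbers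
  congruent to 1 modulo \<open>M\<close>. The bound on the weighted sum would then bound the
  harmonic series.\<close>

theorem exists_prime_sum_neg: "\<exists>q. prime q \<and> a q + b q < 0"
proof (rule ccontr)
  assume "\<not> ?thesis"
  then have "a q + b q \<ge> 0" if "prime q" for q using that not_less by blast
  note bounds = conv_bounds[OF this]
  define C where "C = 4 * real M * L + 4 * M + 4 * L"
  have le: "(\<Sum>k<K. inverse (real (Suc k))) \<le> M * C" for K
  proof -
    \<comment> \<open>At \<open>Suc (k * M)\<close> the character \<open>a\<close> is 1, so its
      square has \<open>conv\<close> at least 1. The root of \<open>g k\<close> is at most
      \<open>M * Suc k\<close>, so the terms dominate a multiple of the harmonic series.\<close>
    define g where "g k = (Suc (k * M))\<^sup>2" for k
    define N where "N = Suc (K * M)"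
    have inj: "inj_on g {..<K}"
      using a.modulus_pos by (auto simp: g_def inj_on_def power2_eq_iff_nonneg)
    have "g ` {..<K} \<subseteq> {1..N\<^sup>2}"
      by (auto simp: g_def N_def intro!: power_mono)
    have "1 / real (M * Suc k) \<le> conv (g k) / sqrt (g k)" for k
    proof -
      have "a (1 + k * M) = 1"
        using a.periodic[of "1 + k * M"] a.periodic[of 1] a.one by (simp only: mod_mult_self1)
      then have "1 \<le> conv (g k)" using bounds[of "Suc (k * M)"] by (simp add: g_def)
      moreover have "sqrt (g k) = Suc (k * M)" by (simp add: g_def)
      moreover have "real (Suc (k * M)) \<le> real (M * Suc k)"
        using a.modulus_pos by (simp only: of_nat_le_iff) (simp add: mult.commute)
      ultimately show ?thesis
        by (simp only:) (rule frac_le, simp_all del: of_nat_Suc)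
    qed
    then have "(\<Sum>k<K. 1 / real (M * Suc k)) \<le> (\<Sum>k<K. conv (g k) / sqrt (g k))"
      by (rule sum_mono)
    also have "\<dots> = (\<Sum>n\<in>g ` {..<K}. conv n / sqrt n)"
      by (simp add: sum.reindex[OF inj])
    also have "\<dots> \<le> (\<Sum>n\<in>{1..N\<^sup>2}. conv n / sqrt n)"
      using bounds \<open>g ` {..<K} \<subseteq> {1..N\<^sup>2}\<close> by (intro sum_mono2) auto
    also have "\<dots> \<le> C" using sum_conv_le[of N] by (simp add: C_def)
    finally have "M * (\<Sum>k<K. 1 / real (M * Suc k)) \<le> M * C"
      by (intro mult_left_mono) auto
    moreover have "M * (\<Sum>k<K. 1 / real (M * Suc k)) = (\<Sum>k<K. inverse (real (Suc k)))"
      unfolding sum_distrib_left using a.modulus_pos by (intro sum.cong) (simp_all add: inverse_eq_divide del: of_nat_Suc mult_Suc_right)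
    ultimately show ?thesis by simp
  qed
  have "summable (\<lambda>k. inverse (real (Suc k)))"
    by (rule bounded_imp_summable[where B = "M * C"])
      (use le in \<open>auto simp flip: lessThan_Suc_atMost simp del: of_nat_Suc sum.lessThan_Suc\<close>)
  then show False
    using not_summable_harmonic[where 'a = real] summable_Suc_iff[of "\<lambda>k. inverse (real k)"] by simp
qed

end

section \<open>Multiplicativity and nonresidues for the Legendre symbol\<close>

lemma Legendre_range: "Legendre a p \<in> {-1, 0, 1}"
  by (simp add: Legendre_def)

lemma Legendre_cong:
  assumes "[a = b] (mod p)"
  shows "Legendre a p = Legendre b p"
  using assms by (simp add: Legendre_def QuadRes_def cong_def)

text \<open>Euler's criterion gives the identity modulo \<open>p\<close>. Both sides lie in {-1, 0,
  1}, so they differ by at most 2, and \<open>p > 2\<close> turns the congruence into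
  equality.\<close>

lemma Legendre_mult:
  fixes p :: nat
  assumes "prime p" "p > 2"
  shows "Legendre (a * b) (int p) = Legendre a p * Legendre b p"
proof -
  let ?k = "(p - 1) div 2"
  have euler: "[Legendre c p = c ^ ?k] (mod p)" for c
    by (rule euler_criterion[OF assms])
  have "[Legendre a p * Legendre b p = a ^ ?k * b ^ ?k] (mod p)"
    by (intro cong_mult euler)
  then have "[Legendre (a * b) p = Legendre a p * Legendre b p] (mod p)"
    using euler[of "a * b"] unfolding power_mult_distrib by (metis cong_sym cong_trans)
  then have "int p dvd Legendre (a * b) p - Legendre a p * Legendre b p"
    by (simp add: cong_iff_dvd_diff)
  moreover have "\<bar>Legendre (a * b) p - Legendre a p * Legendre b p\<bar> < int p"
    using Legendre_range[of "a * b" p] Legendre_range[of a p] Legendre_range[of b p] assms(2) by auto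
  ultimately have "Legendre (a * b) p - Legendre a p * Legendre b p = 0"
    using dvd_imp_le_int[of "Legendre (a * b) p - Legendre a p * Legendre b p" "int p"] by force
  then show ?thesis by simp
qed

text \<open>Squaring on the nonzero residues is not injective, since \<open>p - 1\<close> and 1 have
  the same square; on a finite set it therefore misses some value.\<close>

lemma exists_Legendre_eq_minus_1:
  fixes p :: nat
  assumes p: "prime p" "p > 2"
  obtains a :: nat where "Legendre a p = -1"
proof -
  let ?S = "{0<..<p}"
  have "\<exists>a\<in>?S. \<forall>x\<in>?S. x\<^sup>2 mod p \<noteq> a"
  proof (rule ccontr)
    assume "\<not> ?thesis"
    then have *: "\<exists>x\<in>?S. x\<^sup>2 mod p = a" if "a \<in> ?S" for a using that by blast
    have "?S \<subseteq> (\<lambda>x. x\<^sup>2 mod p) ` ?S"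
    proof
      fix a assume "a \<in> ?S"
      then obtain x where "x \<in> ?S" "x\<^sup>2 mod p = a" using * by blast
      then show "a \<in> (\<lambda>x. x\<^sup>2 mod p) ` ?S" by (intro image_eqI[where x = x]) simp_all
    qed
    with finite_surj_inj have "inj_on (\<lambda>x. x\<^sup>2 mod p) ?S" by blast
    moreover have "(p - 1)\<^sup>2 mod p = 1\<^sup>2 mod p"
    proof -
      have "int ((p - 1)\<^sup>2) = 1 + int p * (int p - 2)"
        using p unfolding of_nat_power by (simp add: of_nat_diff power2_eq_square algebra_simps)
      then have "[int ((p - 1)\<^sup>2) = int (1\<^sup>2)] (mod int p)"
        by (simp add: cong_iff_dvd_diff)
      then have "[(p - 1)\<^sup>2 = 1\<^sup>2] (mod p)" by (simp only: cong_int_iff)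
      then show ?thesis by (simp only: cong_def)
    qed
    moreover have "p - 1 \<in> ?S" "1 \<in> ?S" using p by simp_all
    ultimately have "p - 1 = 1" by (rule inj_onD)
    with p show False by simp
  qed
  then obtain a where "a \<in> ?S" and no: "\<And>x. x \<in> ?S \<Longrightarrow> x\<^sup>2 mod p \<noteq> a" by blast
  then have a: "0 < a" "a < p" by simp_all
  have "\<not> [int a = 0] (mod int p)"
    using a by (simp add: cong_def)
  moreover have "\<not> QuadRes p a"
  proof
    assume "QuadRes p a"
    then obtain y where y: "[y\<^sup>2 = int a] (mod int p)" unfolding QuadRes_def by blast
    define x where "x = nat (y mod p)"
    have x: "int x = y mod p" using p by (simp add: x_def)
    then have "[int (x\<^sup>2) = int a] (mod int p)"
      using y by (simp add: cong_def power_mod)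
    then have "[x\<^sup>2 = a] (mod p)" by (simp only: cong_int_iff)
    then have xa: "x\<^sup>2 mod p = a" using a by (simp add: cong_def)
    then have "x \<noteq> 0" using a by (intro notI) simp
    moreover have "int x < int p" unfolding x using p by simp
    ultimately show False using no[of x] xa by simp
  qed
  ultimately show ?thesis using that[of a] by (simp add: Legendre_def)
qed

section \<open>The characters modulo 4 and modulo \<open>2 * p\<close>\<close>

definition chi4 :: "nat \<Rightarrow> real"
  where "chi4 n = (if n mod 4 = 1 then 1 else if n mod 4 = 3 then -1 else 0)"

lemma nonprincipal_real_character_chi4: "nonprincipal_real_character 4 chi4"
proof
  fix m n :: nat
  have "m mod 4 \<in> {0, 1, 2, 3}" "n mod 4 \<in> {0, 1, 2, 3}" by auto
  then show "chi4 (m * n) = chi4 m * chi4 n"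
    unfolding chi4_def mod_mult_eq[of m 4 n, symmetric] by (elim insertE emptyE) simp_all
  show "chi4 (n mod 4) = chi4 n" "chi4 n \<in> {-1, 0, 1}" by (simp_all add: chi4_def)
  have "coprime n 4 \<longleftrightarrow> odd n"
    using coprime_power_right_iff[of n 2 2] by (simp add: coprime_right_2_iff_odd)
  also have "odd n \<longleftrightarrow> n mod 4 = 1 \<or> n mod 4 = 3" by presburger
  finally show "chi4 n = 0 \<longleftrightarrow> \<not> coprime n 4" by (auto simp: chi4_def)
  have "chi4 3 = -1" by (simp add: chi4_def)
  then show "\<exists>a. chi4 a = -1" ..
qed simp

text \<open>
  Restricting to odd numbers makes the convolution with \<open>chi4\<close> vanish at the positive powers of 2;
  otherwise it would be negative at 2 for \<open>p \<equiv> 5\<close> mod 8.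
\<close>

definition odd_Legendre :: "nat \<Rightarrow> nat \<Rightarrow> real"
  where "odd_Legendre p n = (if even n then 0 else of_int (Legendre n p))"

lemma nonprincipal_real_character_odd_Legendre:
  fixes p :: nat
  assumes p: "prime p" "p > 2"
  shows "nonprincipal_real_character (2 * p) (odd_Legendre p)"
proof
  fix m n :: nat
  show "odd_Legendre p (m * n) = odd_Legendre p m * odd_Legendre p n"
    using Legendre_mult[OF p] by (simp add: odd_Legendre_def)
  have "[n mod (2 * p) = n] (mod p)"
    by (metis cong_def cong_modulus_mult_nat mod_mod_trivial mult.commute)
  then have "Legendre (n mod (2 * p)) p = Legendre n p"
    by (intro Legendre_cong) (simp only: cong_int_iff)
  moreover have "even (n mod (2 * p)) \<longleftrightarrow> even n" by (simp add: dvd_mod_iff)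
  ultimately show "odd_Legendre p (n mod (2 * p)) = odd_Legendre p n"
    by (simp only: odd_Legendre_def)
  show "odd_Legendre p n \<in> {-1, 0, 1}"
    using Legendre_range[of n p] by (auto simp: odd_Legendre_def)
  have "Legendre n p = 0 \<longleftrightarrow> p dvd n"
    by (simp add: Legendre_def cong_0_iff)
  also have "\<dots> \<longleftrightarrow> \<not> coprime n p"
    using p by (metis coprime_commute coprime_absorb_left not_prime_unit prime_imp_coprime)
  finally show "odd_Legendre p n = 0 \<longleftrightarrow> \<not> coprime n (2 * p)"
    by (auto simp: odd_Legendre_def coprime_right_2_iff_odd)
  obtain a :: nat where a: "Legendre a p = -1"
    using exists_Legendre_eq_minus_1[OF p] .
  have "odd p" using p prime_odd_nat by blast
  \<comment> \<open>The nonresidue \<open>a\<close> may be even, where \<open>odd_Legendre\<close>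
    vanishes. Adding the odd number \<open>p\<close> changes the parity but not the residue
    class.\<close>
  have "Legendre (a + p) p = -1"
    using a Legendre_cong[of "int a + int p" "int a" p] by (simp add: cong_def)
  then have "odd_Legendre p (if odd a then a else a + p) = -1"
    using a \<open>odd p\<close> by (simp add: odd_Legendre_def)
  then show "\<exists>a. odd_Legendre p a = -1" ..
  show "2 * p > 0" using p by simp
qed

section \<open>Conclusion by quadratic reciprocity\<close>

theorem lemma1p3:
  fixes p :: nat
  assumes "prime p" and "[p = 1] (mod 4)"
  shows "\<exists>q :: nat. prime q \<and> [q = 3] (mod 4) \<and> Legendre (int p) (int q) = -1"
proof -
  have p4: "p mod 4 = 1" using assms(2) by (simp add: cong_def)
  then have p2: "p > 2" using prime_gt_1_nat[OF assms(1)] by (cases "p = 2") auto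
  interpret two_real_characters 4 chi4 "2 * p" "odd_Legendre p"
    by (intro two_real_characters.intro nonprincipal_real_character_chi4
        nonprincipal_real_character_odd_Legendre assms(1) p2)
  obtain q where q: "prime q" and neg: "chi4 q + odd_Legendre p q < 0"
    using exists_prime_sum_neg by blast
  \<comment> \<open>Both characters vanish at even numbers, so their sum is not negative
    there.\<close>
  have odd: "odd q" using neg by (auto simp: chi4_def odd_Legendre_def split: if_splits; presburger)
  have "Legendre p p = 0" by (simp add: Legendre_def cong_0_iff)
  \<comment> \<open>At \<open>p\<close> itself the sum would be 1 + 0.\<close>
  then have "q \<noteq> p" using neg p4 by (auto simp: chi4_def odd_Legendre_def split: if_splits)
  then have "\<not> p dvd q" using primes_dvd_imp_eq[OF assms(1) q] by auto
  then have "Legendre q p \<noteq> 0" by (simp add: Legendre_def cong_0_iff)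
  \<comment> \<open>Both values are now 1 or -1, so a negative sum forces both to be -1.\<close>
  with neg odd have q4: "q mod 4 = 3" and Lq: "Legendre q p = -1"
    using Legendre_range[of q p] by (auto simp: chi4_def odd_Legendre_def split: if_splits; presburger)+
  have "q > 2" using q4 prime_gt_1_nat[OF q] by (cases "q = 2") auto
  \<comment> \<open>This makes the exponent of -1 in the reciprocity law even, so the two symbols
    agree.\<close>
  moreover have "even ((p - 1) div 2)" using p4 by presburger
  ultimately have "Legendre p q * Legendre q p = 1"
    using Quadratic_Reciprocity[OF assms(1) p2 q] \<open>q \<noteq> p\<close> by simp
  then have "Legendre p q = -1" using Lq by simp
  with q q4 show ?thesis by (auto simp: cong_def)
qed

end
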